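(* Let $F_2$ be the free group on $x,y$, let $n\ge 1$, and let $e_n=[x,_n y]\in F_2$ be the $n$-th Engel word. Then $e_n$ is achiral if and only if there exists an automorphism $\sigma$ of $F_2$ with $\sigma(e_n)=e_n^{-1}$.
   Context: For a word $w$ in the free group $F_2$ on $x,y$ and a group $G$, the word map of $w$ on $G$ is the map $G^2\to G$, $(g_1,g_2)\mapsto w(g_1,g_2)$, obtained by substituting $g_1$ for $x$ and $g_2$ for $y$; its image is denoted $G_w$. A word $w$ is achiral if $G_w=G_{w^{-1}}$ for every group $G$. The Engel words are defined by $[x,_1 y]=[x,y]$ and $[x,_{n+1}y]=[[x,_n y],y]$, where $[a,b]=aba^{-1}b^{-1}$. *)

theory Defs
  imports "HOL-Algebra.Group" "HOL-Library.Infinite_Typeclass" "HOL-Library.Countable"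
begin

section \<open>The free group on two generators\<close>

datatype gen = GenX | GenY

instance gen :: countable
  by countable_datatype

text \<open>A letter is a generator with a sign: \<open>(s, True)\<close> stands for \<open>s\<close> and \<open>(s, False)\<close> for its inverse.
  The elements of \<open>F2\<close> are the reduced words; they are multiplied by concatenation and reduction.\<close>

type_synonym letter = "gen \<times> bool"

definition flip :: "letter \<Rightarrow> letter" where
  "flip a = (fst a, \<not> snd a)"

definition reduced :: "letter list \<Rightarrow> bool" where
  "reduced = successively (\<lambda>a b. b \<noteq> flip a)"

fun push :: "letter \<Rightarrow> letter list \<Rightarrow> letter list" where
  "push a [] = [a]"
| "push a (b # w) = (if b = flip a then w else a # b # w)"

definition F2 :: "letter list monoid" where
  "F2 = \<lparr>carrier = Collect reduced, mult = \<lambda>u v. foldr push u v, one = []\<rparr>"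

abbreviation F2_x :: "letter list" where "F2_x \<equiv> [(GenX, True)]"
abbreviation F2_y :: "letter list" where "F2_y \<equiv> [(GenY, True)]"

lemma flip_flip [simp]: "flip (flip a) = a"
  by (simp add: flip_def)

lemma flip_neq [simp]: "flip a \<noteq> a" "a \<noteq> flip a"
  by (auto simp: flip_def prod_eq_iff)

lemma reduced_Nil [simp]: "reduced []"
  and reduced_single [simp]: "reduced [a]"
  and reduced_Cons_Cons [simp]: "reduced (a # b # w) \<longleftrightarrow> b \<noteq> flip a \<and> reduced (b # w)"
  by (auto simp: reduced_def)

lemma reduced_ConsD: "reduced (a # w) \<Longrightarrow> reduced w"
  by (cases w) auto

lemma reduced_push: "reduced w \<Longrightarrow> reduced (push a w)"
  by (cases w) (auto dest: reduced_ConsD)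

lemma reduced_foldr_push: "reduced w \<Longrightarrow> reduced (foldr push u w)"
  by (induction u) (auto simp: reduced_push)

lemma push_reduced: "reduced (a # w) \<Longrightarrow> push a w = a # w"
  by (cases w) auto

lemma foldr_push_Nil: "reduced w \<Longrightarrow> foldr push w [] = w"
proof (induction w)
  case (Cons a w)
  then show ?case using reduced_ConsD[of a w] push_reduced[of a w] by simp
qed simp

lemma push_flip_push: "reduced w \<Longrightarrow> push a (push (flip a) w) = w"
proof (cases w)
  case (Cons b v)
  assume "reduced w"
  with Cons show ?thesis by (cases v) auto
qed auto

lemma foldr_push_push: "reduced w \<Longrightarrow> foldr push (push a v) w = push a (foldr push v w)"
  by (cases v) (auto simp: reduced_foldr_push push_flip_push)

lemma foldr_push_assoc:
  "reduced w \<Longrightarrow> foldr push (foldr push u v) w = foldr push u (foldr push v w)"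
  by (induction u) (auto simp: foldr_push_push)

lemma foldr_push_flip: "reduced w \<Longrightarrow> foldr push (rev (map flip u)) (foldr push u w) = w"
proof (induction u arbitrary: w)
  case (Cons a u)
  then show ?case
    using push_flip_push[of "foldr push u w" "flip a"] by (simp add: reduced_foldr_push)
qed simp

lemma group_F2: "group F2"
proof (rule groupI)
  fix u assume "u \<in> carrier F2"
  then have u: "reduced u" by (simp add: F2_def)
  let ?v = "foldr push (rev (map flip u)) []"
  have "foldr push ?v u = foldr push (rev (map flip u)) (foldr push u [])"
    using u by (simp add: foldr_push_assoc foldr_push_Nil)
  also have "\<dots> = []" by (simp add: foldr_push_flip)
  finally show "\<exists>v\<in>carrier F2. v \<otimes>\<^bsub>F2\<^esub> u = \<one>\<^bsub>F2\<^esub>"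
    by (intro bexI[of _ ?v]) (auto simp: F2_def reduced_foldr_push)
qed (auto simp: F2_def reduced_foldr_push foldr_push_assoc)

section \<open>Word maps\<close>

definition letter_val :: "('g, 'm) monoid_scheme \<Rightarrow> 'g \<Rightarrow> 'g \<Rightarrow> letter \<Rightarrow> 'g" where
  "letter_val G g h a =
     (let s = (case fst a of GenX \<Rightarrow> g | GenY \<Rightarrow> h) in if snd a then s else inv\<^bsub>G\<^esub> s)"

definition word_map :: "('g, 'm) monoid_scheme \<Rightarrow> letter list \<Rightarrow> 'g \<Rightarrow> 'g \<Rightarrow> 'g" where
  "word_map G w g h = foldr (\<lambda>a r. letter_val G g h a \<otimes>\<^bsub>G\<^esub> r) w \<one>\<^bsub>G\<^esub>"

definition word_image :: "('g, 'm) monoid_scheme \<Rightarrow> letter list \<Rightarrow> 'g set" where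
  "word_image G w = {word_map G w g h |g h. g \<in> carrier G \<and> h \<in> carrier G}"

text \<open>HOL cannot quantify over all types inside a formula, so the groups range over those with
  carrier in an arbitrary infinite type. The lemma \<open>achiral_imp_word_image_eq\<close> below shows that
  this covers all groups of all types.\<close>

definition achiral :: "'g::infinite itself \<Rightarrow> letter list \<Rightarrow> bool" where
  "achiral _ w \<longleftrightarrow>
     (\<forall>G :: 'g monoid. group G \<longrightarrow> word_image G w = word_image G (inv\<^bsub>F2\<^esub> w))"

lemma letter_val_closed:
  "group G \<Longrightarrow> g \<in> carrier G \<Longrightarrow> h \<in> carrier G \<Longrightarrow> letter_val G g h a \<in> carrier G"
  by (auto simp: letter_val_def Let_def split: gen.split intro: group.inv_closed)

lemma letter_val_flip:
  "group G \<Longrightarrow> g \<in> carrier G \<Longrightarrow> h \<in> carrier G \<Longrightarrow>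
     letter_val G g h (flip a) = inv\<^bsub>G\<^esub> (letter_val G g h a)"
  by (auto simp: letter_val_def Let_def flip_def group.inv_inv split: gen.split)

lemma word_map_closed:
  "group G \<Longrightarrow> g \<in> carrier G \<Longrightarrow> h \<in> carrier G \<Longrightarrow> word_map G w g h \<in> carrier G"
  by (induction w)
    (auto simp: word_map_def letter_val_closed group.is_monoid intro!: monoid.m_closed monoid.one_closed)

lemma word_map_Nil: "word_map G [] g h = \<one>\<^bsub>G\<^esub>"
  and word_map_Cons: "word_map G (a # w) g h = letter_val G g h a \<otimes>\<^bsub>G\<^esub> word_map G w g h"
  by (simp_all add: word_map_def)

lemma word_map_push:
  assumes "group G" "g \<in> carrier G" "h \<in> carrier G"
  shows "word_map G (push a w) g h = letter_val G g h a \<otimes>\<^bsub>G\<^esub> word_map G w g h"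
proof -
  interpret group G by fact
  show ?thesis
    using assms
    by (cases w)
      (auto simp: word_map_Cons word_map_Nil letter_val_flip letter_val_closed word_map_closed
        m_assoc[symmetric])
qed

lemma word_map_hom:
  assumes "group G" "g \<in> carrier G" "h \<in> carrier G"
  shows "(\<lambda>w. word_map G w g h) \<in> hom F2 G"
proof -
  interpret group G by fact
  have "word_map G (foldr push u v) g h = word_map G u g h \<otimes>\<^bsub>G\<^esub> word_map G v g h" for u v
    using assms
    by (induction u)
      (simp_all add: word_map_push word_map_Nil word_map_Cons word_map_closed letter_val_closed m_assoc)
  then show ?thesis
    using assms by (auto simp: hom_def F2_def word_map_closed)
qed

lemma word_map_generators:
  assumes "group G" "g \<in> carrier G" "h \<in> carrier G"
  shows "word_map G F2_x g h = g" "word_map G F2_y g h = h"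
  using assms by (simp_all add: word_map_def letter_val_def group.is_monoid monoid.r_one)

lemma hom_word_map:
  assumes "group G" "group H" "\<phi> \<in> hom G H" "g \<in> carrier G" "h \<in> carrier G"
  shows "\<phi> (word_map G w g h) = word_map H w (\<phi> g) (\<phi> h)"
proof -
  interpret group_hom G H \<phi> using assms by (auto simp: group_hom_def group_hom_axioms_def)
  have "\<phi> (letter_val G g h a) = letter_val H (\<phi> g) (\<phi> h) a" for a
    using assms by (auto simp: letter_val_def Let_def split: gen.split)
  then show ?thesis
    using assms
    by (induction w) (simp_all add: word_map_Nil word_map_Cons word_map_closed letter_val_closed)
qed

lemma F2_generators: "F2_x \<in> carrier F2" "F2_y \<in> carrier F2"
  by (simp_all add: F2_def)

lemma word_map_F2:
  assumes "w \<in> carrier F2"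
  shows "word_map F2 w F2_x F2_y = w"
proof -
  interpret group F2 by (rule group_F2)
  have F: "inv\<^bsub>F2\<^esub> [(s, True)] = [(s, False)]" for s
    by (rule inv_equality) (auto simp: F2_def flip_def)
  have "letter_val F2 F2_x F2_y a = [a]" for a
    by (cases a) (auto simp: letter_val_def Let_def F split: gen.split)
  then have "word_map F2 w F2_x F2_y = foldr push w []"
    by (simp add: word_map_def F2_def)
  then show ?thesis using assms by (simp add: F2_def foldr_push_Nil)
qed

lemma achiral_imp_word_image_eq:
  fixes H :: "'h monoid"
  assumes ach: "achiral TYPE('g::infinite) w" and w: "w \<in> carrier F2" and H: "group H"
  shows "word_image H w = word_image H (inv\<^bsub>F2\<^esub> w)"
proof -
  interpret F: group F2 by (rule group_F2)
  interpret H: group H by fact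
  obtain \<iota> :: "nat \<Rightarrow> 'g" where "inj \<iota>"
    using infinite_countable_subset[OF infinite_UNIV[where 'a = 'g]] by auto
  define j :: "letter list \<Rightarrow> 'g" where "j = \<iota> \<circ> to_nat"
  have inj: "inj j"
    unfolding j_def using \<open>inj \<iota>\<close> inj_to_nat by (rule inj_compose)
  have [simp]: "inv_into UNIV j (j u) = u" for u
    using inj by simp
  define G :: "'g monoid" where
    "G = \<lparr>carrier = j ` carrier F2, mult = \<lambda>a b. j (inv_into UNIV j a \<otimes>\<^bsub>F2\<^esub> inv_into UNIV j b),
          one = j \<one>\<^bsub>F2\<^esub>\<rparr>"
  have G: "group G"
  proof (rule groupI)
    fix a assume "a \<in> carrier G"
    then obtain u where "u \<in> carrier F2" "a = j u" by (auto simp: G_def)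
    then show "\<exists>b\<in>carrier G. b \<otimes>\<^bsub>G\<^esub> a = \<one>\<^bsub>G\<^esub>"
      by (intro bexI[of _ "j (inv\<^bsub>F2\<^esub> u)"]) (auto simp: G_def)
  qed (auto simp: G_def F.m_assoc)
  have j: "j \<in> hom F2 G"
    by (auto simp: hom_def G_def)
  have "j w = word_map G w (j F2_x) (j F2_y)"
    using hom_word_map[OF group_F2 G j F2_generators, of w] word_map_F2[OF w] by simp
  then have "j w \<in> word_image G w"
    using F2_generators by (auto simp: word_image_def G_def)
  then have "j w \<in> word_image G (inv\<^bsub>F2\<^esub> w)"
    using ach G by (simp add: achiral_def)
  then obtain u v where uv: "u \<in> carrier F2" "v \<in> carrier F2"
    and "j w = word_map G (inv\<^bsub>F2\<^esub> w) (j u) (j v)"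
    by (auto simp: word_image_def G_def)
  then have w_eq: "w = word_map F2 (inv\<^bsub>F2\<^esub> w) u v"
    using hom_word_map[OF group_F2 G j uv] inj by (metis injD)
  have hom: "group_hom F2 F2 (\<lambda>w. word_map F2 w u v)"
    using word_map_hom[OF group_F2 uv] group_F2 by (simp add: group_hom_def group_hom_axioms_def)
  have inv_eq: "inv\<^bsub>F2\<^esub> w = word_map F2 w u v"
    using w_eq group_hom.hom_inv[OF hom w] uv w by (metis F.inv_inv word_map_closed group_F2)
  have sub: "word_image H (word_map F2 t u v) \<subseteq> word_image H t" for t
  proof
    fix z assume "z \<in> word_image H (word_map F2 t u v)"
    then obtain g h where gh: "g \<in> carrier H" "h \<in> carrier H"
      and z: "z = word_map H (word_map F2 t u v) g h"
      by (auto simp: word_image_def)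
    have "z = word_map H t (word_map H u g h) (word_map H v g h)"
      using z hom_word_map[OF group_F2 H word_map_hom[OF H gh] uv] by simp
    then show "z \<in> word_image H t"
      using word_map_closed[OF H gh] by (auto simp: word_image_def)
  qed
  show ?thesis
    using sub[of w] sub[of "inv\<^bsub>F2\<^esub> w"] w_eq inv_eq by auto
qed

section \<open>Engel words\<close>

definition commutator :: "('g, 'm) monoid_scheme \<Rightarrow> 'g \<Rightarrow> 'g \<Rightarrow> 'g" where
  "commutator G a b = a \<otimes>\<^bsub>G\<^esub> b \<otimes>\<^bsub>G\<^esub> inv\<^bsub>G\<^esub> a \<otimes>\<^bsub>G\<^esub> inv\<^bsub>G\<^esub> b"

fun engel :: "('g, 'm) monoid_scheme \<Rightarrow> 'g \<Rightarrow> nat \<Rightarrow> 'g \<Rightarrow> 'g" where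
  "engel G a 0 b = a"
| "engel G a (Suc n) b = commutator G (engel G a n b) b"

definition engel_word :: "nat \<Rightarrow> letter list" where
  "engel_word n = engel F2 F2_x n F2_y"

end

theory Submission
  imports Defs "HOL-Algebra.Coset"
begin

text \<open>
  The substance of the theorem is that an Engel word \<open>e\<close> is a test word: an endomorphism of the free
  group \<open>F2\<close> that fixes \<open>e\<close>, or sends it to its inverse, is an automorphism. Indeed, achirality
  applied to the group \<open>F2\<close> itself yields two elements at which \<open>e\<close> takes the value \<open>e\<^sup>-\<^sup>1\<close>, that is,
  an endomorphism inverting \<open>e\<close>. Conversely, if an endomorphism inverts \<open>e\<close>, then by substitution the
  inverse of every value of \<open>e\<close> in any group is again a value (\<open>word_image_end_subset\<close>).

  All that is used of \<open>e\<close> is that it is a nontrivial element of the commutator subgroup. Let \<open>\<phi>\<close> be an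
  endomorphism fixing such a word \<open>w\<close>. Its powers also fix \<open>w\<close>, and by Nielsen's method each of them
  can be composed with an automorphism \<open>\<alpha>\<^sub>k\<close> so that \<open>\<psi>\<^sub>k = \<phi>\<^sup>k \<circ> \<alpha>\<^sub>k\<close> sends the generators to a Nielsen
  reduced pair (\<open>nielsen_reduction\<close>). Under such a \<open>\<psi>\<^sub>k\<close>, the image of a reduced word is at least as
  long as the image of each letter in it (\<open>nielsen_reduced_length_ge\<close>). Now \<open>\<alpha>\<^sub>k\<^sup>-\<^sup>1(w)\<close> contains both
  generators, since a nontrivial power of one generator is not in the commutator subgroup, and \<open>\<psi>\<^sub>k\<close>
  sends it to \<open>w\<close>. So the generators have images of length at most that of \<open>w\<close> under all the \<open>\<psi>\<^sub>k\<close>,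
  and \<open>\<psi>\<^sub>i = \<psi>\<^sub>j\<close> for some \<open>i < j\<close>. As a Nielsen reduced map is injective, so is \<open>\<phi>\<close>, and cancelling
  \<open>\<phi>\<^sup>i\<close> shows that \<open>\<phi>\<^bsup>j-i\<^esup>\<close> is surjective.

  Cancellation is measured by longest common prefixes: the product of \<open>u\<^sup>-\<^sup>1\<close> and \<open>v\<close> cancels exactly
  the common prefix of \<open>u\<close> and \<open>v\<close>, and common prefixes obey an ultrametric inequality. The
  arguments about cancellation below use little more than these two facts.
\<close>

interpretation F2: group F2
  by (rule group_F2)

abbreviation F2_mult :: "letter list \<Rightarrow> letter list \<Rightarrow> letter list" (infixl "\<cdot>" 70) where
  "u \<cdot> v \<equiv> u \<otimes>\<^bsub>F2\<^esub> v"

section \<open>Word length and common prefixes\<close>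

lemma carrier_F2: "u \<in> carrier F2 \<longleftrightarrow> reduced u"
  by (simp add: F2_def)

lemma one_F2: "\<one>\<^bsub>F2\<^esub> = []"
  by (simp add: F2_def)

lemma mult_F2: "u \<cdot> v = foldr push u v"
  by (simp add: F2_def)

lemma reduced_append:
  "reduced (u @ v) \<longleftrightarrow> reduced u \<and> reduced v \<and> (u \<noteq> [] \<longrightarrow> v \<noteq> [] \<longrightarrow> hd v \<noteq> flip (last u))"
  by (auto simp: reduced_def successively_append_iff)

lemma flip_eq_iff: "flip a = b \<longleftrightarrow> a = flip b"
  by auto

lemma reduced_rev_map_flip: "reduced u \<Longrightarrow> reduced (rev (map flip u))"
proof (induction u)
  case (Cons a u)
  then show ?case
    by (cases u) (auto simp: reduced_append flip_eq_iff)
qed simp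

lemma inv_F2:
  assumes "reduced u"
  shows "inv\<^bsub>F2\<^esub> u = rev (map flip u)"
proof (rule F2.inv_equality)
  show "rev (map flip u) \<cdot> u = \<one>\<^bsub>F2\<^esub>"
    using foldr_push_flip[of "[]" u] assms by (simp add: mult_F2 one_F2 foldr_push_Nil)
qed (use assms in \<open>simp_all add: carrier_F2 reduced_rev_map_flip\<close>)

lemma length_inv: "u \<in> carrier F2 \<Longrightarrow> length (inv\<^bsub>F2\<^esub> u) = length u"
  by (simp add: carrier_F2 inv_F2)

lemma inv_letter: "inv\<^bsub>F2\<^esub> [a] = [flip a]"
  by (simp add: inv_F2)

lemma letter_closed: "[a] \<in> carrier F2"
  by (simp add: carrier_F2)

lemma Cons_eq_mult: "reduced (a # w) \<Longrightarrow> a # w = [a] \<cdot> w"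
  by (simp add: mult_F2 push_reduced)

lemma foldr_push_append: "reduced (u @ v) \<Longrightarrow> foldr push u v = u @ v"
proof (induction u)
  case (Cons a u)
  then show ?case using push_reduced[of a "u @ v"] reduced_ConsD[of a "u @ v"] by simp
qed simp

fun lcp :: "'a list \<Rightarrow> 'a list \<Rightarrow> nat" where
  "lcp (a # u) (b # v) = (if a = b then Suc (lcp u v) else 0)"
| "lcp u v = 0"

lemma lcp_commute: "lcp u v = lcp v u"
  by (induction u v rule: lcp.induct) auto

lemma lcp_ultrametric: "min (lcp u v) (lcp v w) \<le> lcp u w"
proof (induction u v arbitrary: w rule: lcp.induct)
  case (1 a u b v)
  then show ?case by (cases w) auto
qed auto

lemma lcp_isosceles: "lcp u v < lcp v w \<Longrightarrow> lcp u w = lcp u v"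
  using lcp_ultrametric[of u v w] lcp_ultrametric[of u w v] by (simp add: lcp_commute[of w v])

lemma lcp_nth: "i < lcp u v \<Longrightarrow> u ! i = v ! i"
proof (induction u v arbitrary: i rule: lcp.induct)
  case (1 a u b v)
  then show ?case by (cases i) (auto split: if_splits)
qed auto

text \<open>After the common prefix is removed, the remainders start with different letters, so nothing
  more cancels between them.\<close>

lemma length_inv_mult:
  assumes "u \<in> carrier F2" "v \<in> carrier F2"
  shows "length (inv\<^bsub>F2\<^esub> u \<cdot> v) + 2 * lcp u v = length u + length v"
proof -
  have "reduced u \<Longrightarrow> reduced v \<Longrightarrow>
    length (foldr push (rev (map flip u)) v) + 2 * lcp u v = length u + length v"
  proof (induction u v rule: lcp.induct)
    case (1 a u b v)
    show ?case
    proof (cases "a = b")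
      case True
      with 1 show ?thesis by (auto dest: reduced_ConsD)
    next
      case False
      have "reduced (rev (map flip (a # u)))"
        using 1(2) by (rule reduced_rev_map_flip)
      then have "reduced (rev (map flip (a # u)) @ b # v)"
        using 1(3) False by (auto simp: reduced_append)
      from foldr_push_append[OF this] False show ?thesis by simp
    qed
  next
    case ("2_2" u)
    then show ?case
      using foldr_push_Nil[OF reduced_rev_map_flip, of u] by simp
  qed (auto simp: foldr_push_Nil)
  then show ?thesis using assms by (simp add: carrier_F2 inv_F2 mult_F2)
qed

lemma length_mult:
  assumes "u \<in> carrier F2" "v \<in> carrier F2"
  shows "length (u \<cdot> v) + 2 * lcp (inv\<^bsub>F2\<^esub> u) v = length u + length v"
  using length_inv_mult[of "inv\<^bsub>F2\<^esub> u" v] assms by (simp add: length_inv)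

lemma lcp_mult:
  assumes "u \<in> carrier F2" "v \<in> carrier F2"
  shows "2 * lcp u (u \<cdot> v) + length v = length u + length (u \<cdot> v)"
proof -
  have "inv\<^bsub>F2\<^esub> u \<cdot> (u \<cdot> v) = v"
    using assms by (simp add: F2.m_assoc[symmetric])
  then show ?thesis using length_inv_mult[of u "u \<cdot> v"] assms by simp
qed

text \<open>This bounds the cancellation in the square of \<open>u\<close>. If the first half of
  \<open>u\<close> agreed with that of its inverse, then around the middle of \<open>u\<close> there would be either a letter
  equal to its own inverse or two adjacent letters inverse to each other.\<close>

lemma lcp_inv_less:
  assumes u: "u \<in> carrier F2" and "u \<noteq> []"
  shows "2 * lcp u (inv\<^bsub>F2\<^esub> u) < length u"
proof (rule ccontr)
  assume less: "\<not> ?thesis"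
  have red: "reduced u" using u by (simp add: carrier_F2)
  have nth: "u ! i = flip (u ! (length u - Suc i))" if "2 * i < length u" for i
  proof -
    have "u ! i = (inv\<^bsub>F2\<^esub> u) ! i"
      using that less by (intro lcp_nth) auto
    then show ?thesis using that by (simp add: inv_F2[OF red] rev_nth)
  qed
  define k where "k = (length u - 1) div 2"
  have k: "2 * k < length u" using \<open>u \<noteq> []\<close> by (cases u) (auto simp: k_def)
  show False
  proof (cases "even (length u)")
    case True
    then obtain b where b: "length u = 2 * b" by (elim evenE)
    with \<open>u \<noteq> []\<close> obtain c where "b = Suc c" by (cases b) auto
    with b have len: "length u - Suc k = Suc k" "Suc k < length u"
      by (simp_all add: k_def)
    have "u ! Suc k \<noteq> flip (u ! k)"
      using red len(2) by (simp add: reduced_def successively_conv_nth)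
    with nth[OF k] len show False by simp
  next
    case False
    then have "length u - Suc k = k" by (auto simp: k_def elim!: oddE)
    with nth[OF k] show False by simp
  qed
qed

section \<open>Endomorphisms and Nielsen moves\<close>

lemma end_group_hom: "\<phi> \<in> hom F2 F2 \<Longrightarrow> group_hom F2 F2 \<phi>"
  using group_F2 by (simp add: group_hom_def group_hom_axioms_def)

lemma end_inv: "\<phi> \<in> hom F2 F2 \<Longrightarrow> u \<in> carrier F2 \<Longrightarrow> \<phi> (inv\<^bsub>F2\<^esub> u) = inv\<^bsub>F2\<^esub> (\<phi> u)"
  by (rule group_hom.hom_inv[OF end_group_hom])

lemma end_one: "\<phi> \<in> hom F2 F2 \<Longrightarrow> \<phi> [] = []"
  using group_hom.hom_one[OF end_group_hom, of \<phi>] by (simp add: one_F2)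

lemma end_flip: "\<phi> \<in> hom F2 F2 \<Longrightarrow> \<phi> [flip a] = inv\<^bsub>F2\<^esub> (\<phi> [a])"
  using end_inv[of \<phi> "[a]"] by (simp add: inv_letter letter_closed)

lemma length_end_flip: "\<phi> \<in> hom F2 F2 \<Longrightarrow> length (\<phi> [flip a]) = length (\<phi> [a])"
  by (simp add: end_flip length_inv hom_in_carrier letter_closed)

lemma end_Cons: "\<phi> \<in> hom F2 F2 \<Longrightarrow> reduced (a # w) \<Longrightarrow> \<phi> (a # w) = \<phi> [a] \<cdot> \<phi> w"
  using hom_mult[of \<phi> F2 F2 "[a]" w] Cons_eq_mult[of a w] reduced_ConsD[of a w]
  by (simp add: carrier_F2)

lemma end_eq_word_map:
  assumes "\<phi> \<in> hom F2 F2" "w \<in> carrier F2"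
  shows "\<phi> w = word_map F2 w (\<phi> F2_x) (\<phi> F2_y)"
  using hom_word_map[OF group_F2 group_F2 assms(1) F2_generators, of w] assms(2)
  by (simp add: word_map_F2)

lemma end_eqI:
  assumes "\<phi> \<in> hom F2 F2" "\<psi> \<in> hom F2 F2" "\<phi> F2_x = \<psi> F2_x" "\<phi> F2_y = \<psi> F2_y" "w \<in> carrier F2"
  shows "\<phi> w = \<psi> w"
  using end_eq_word_map[of \<phi> w] end_eq_word_map[of \<psi> w] assms by simp

lemma end_comp: "\<phi> \<in> hom F2 F2 \<Longrightarrow> \<psi> \<in> hom F2 F2 \<Longrightarrow> \<phi> \<circ> \<psi> \<in> hom F2 F2"
  by (auto simp: hom_def)

text \<open>The Nielsen transformation that fixes the letter \<open>p\<close> and replaces the letter \<open>q\<close> on the other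
  generator by \<open>p\<^sup>-\<^sup>1q\<close>. For negative \<open>q\<close> the generator itself is sent to the inverse \<open>q\<^sup>-\<^sup>1p\<close>.\<close>

definition nielsen_move :: "letter \<Rightarrow> letter \<Rightarrow> letter list \<Rightarrow> letter list" where
  "nielsen_move p q w =
     (let img = (if snd q then [flip p, q] else [flip q, p])
      in if fst q = GenX then word_map F2 w img F2_y else word_map F2 w F2_x img)"

lemma nielsen_move_hom:
  assumes "fst p \<noteq> fst q"
  shows "nielsen_move p q \<in> hom F2 F2"
proof -
  have red: "(if snd q then [flip p, q] else [flip q, p]) \<in> carrier F2"
    using assms by (auto simp: carrier_F2 flip_def)
  show ?thesis
    unfolding nielsen_move_def Let_def
    by (cases "fst q") (use word_map_hom[OF group_F2 red F2_generators(2)]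
        word_map_hom[OF group_F2 F2_generators(1) red] in simp_all)
qed

lemma nielsen_move_letters:
  assumes "fst p \<noteq> fst q"
  shows "nielsen_move p q [p] = [p]" "nielsen_move p q [q] = [flip p, q]"
proof -
  obtain g s h t where pq: "p = (g, s)" "q = (h, t)" by (metis prod.exhaust)
  show "nielsen_move p q [p] = [p]"
    using assms unfolding pq
    by (cases g; cases h; cases s)
      (simp_all add: nielsen_move_def word_map_def letter_val_def Let_def mult_F2 one_F2 inv_F2 flip_def)
  show "nielsen_move p q [q] = [flip p, q]"
    using assms unfolding pq
    by (cases g; cases h; cases s; cases t)
      (simp_all add: nielsen_move_def word_map_def letter_val_def Let_def mult_F2 one_F2 inv_F2 flip_def)
qed

lemma end_eqI_letters:
  assumes "\<phi> \<in> hom F2 F2" "\<psi> \<in> hom F2 F2" "fst p \<noteq> fst q"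
    and "\<phi> [p] = \<psi> [p]" "\<phi> [q] = \<psi> [q]" "w \<in> carrier F2"
  shows "\<phi> w = \<psi> w"
proof -
  have eq: "\<phi> [(fst r, True)] = \<psi> [(fst r, True)]" if "\<phi> [r] = \<psi> [r]" for r
  proof (cases "snd r")
    case True
    then have "r = (fst r, True)" by (simp add: prod_eq_iff)
    with that show ?thesis by simp
  next
    case False
    then have "(fst r, True) = flip r" by (simp add: flip_def)
    with that show ?thesis using assms(1,2) by (simp add: end_flip)
  qed
  show ?thesis
  proof (rule end_eqI[OF assms(1,2) _ _ assms(6)])
    show "\<phi> F2_x = \<psi> F2_x" "\<phi> F2_y = \<psi> F2_y"
      using eq[OF assms(4)] eq[OF assms(5)] assms(3) by (cases "fst p"; cases "fst q"; simp)+
  qed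
qed

lemma iso_of_inverse:
  assumes "\<phi> \<in> hom F2 F2" "\<psi> \<in> hom F2 F2"
    and "\<And>w. w \<in> carrier F2 \<Longrightarrow> \<phi> (\<psi> w) = w" "\<And>w. w \<in> carrier F2 \<Longrightarrow> \<psi> (\<phi> w) = w"
  shows "\<phi> \<in> iso F2 F2"
proof -
  have "bij_betw \<phi> (carrier F2) (carrier F2)"
    using assms(3,4) hom_in_carrier[OF assms(1)] hom_in_carrier[OF assms(2)]
    by (intro bij_betw_byWitness[where f' = \<psi>]) blast+
  then show ?thesis using assms(1) by (simp add: iso_def)
qed

lemma nielsen_move_iso:
  assumes pq: "fst p \<noteq> fst q"
  shows "nielsen_move p q \<in> iso F2 F2"
proof -
  have inverse: "nielsen_move (flip p) q (nielsen_move p q w) = w"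
    if pq: "fst p \<noteq> fst q" and w: "w \<in> carrier F2" for p w
  proof -
    have fq: "fst (flip p) \<noteq> fst q" using pq by (simp add: flip_def)
    note hom = nielsen_move_hom[OF pq] nielsen_move_hom[OF fq]
    note let1 = nielsen_move_letters[OF pq] and let2 = nielsen_move_letters[OF fq]
    have red: "reduced [flip p, q]" using pq by auto
    have "nielsen_move (flip p) q [p] = [p]"
      using end_flip[OF hom(2), of "flip p"] let2(1) by (simp add: inv_letter)
    moreover have "nielsen_move (flip p) q [flip p, q] = [q]"
      using end_Cons[OF hom(2) red] let2 by (simp add: mult_F2)
    ultimately have
      "(nielsen_move (flip p) q \<circ> nielsen_move p q) [p] = id [p]"
      "(nielsen_move (flip p) q \<circ> nielsen_move p q) [q] = id [q]"
      by (simp_all add: let1)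
    moreover have "id \<in> hom F2 F2" by (simp add: hom_def)
    ultimately have "(nielsen_move (flip p) q \<circ> nielsen_move p q) w = id w"
      using end_eqI_letters[OF end_comp[OF hom(2,1)] _ pq _ _ w] by blast
    then show ?thesis by simp
  qed
  have fq: "fst (flip p) \<noteq> fst q" using pq by (simp add: flip_def)
  show ?thesis
  proof (rule iso_of_inverse[OF nielsen_move_hom[OF pq] nielsen_move_hom[OF fq]])
    fix w assume w: "w \<in> carrier F2"
    show "nielsen_move (flip p) q (nielsen_move p q w) = w"
      using inverse[OF pq w] .
    show "nielsen_move p q (nielsen_move (flip p) q w) = w"
      using inverse[OF fq w] by simp
  qed
qed


section \<open>Nielsen reduced endomorphisms\<close>

text \<open>The conditions say that in a product of images of two adjacent letters of a reduced word at
  most half of either factor cancels, and that an image between two others is never cancelled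
  completely. The product of \<open>\<phi> [a]\<close> and \<open>\<phi> [q]\<close> cancels the common prefix of \<open>\<phi> [flip a]\<close> and
  \<open>\<phi> [q]\<close>; the letter \<open>p\<close> below stands for \<open>flip a\<close>.\<close>

definition nielsen_reduced :: "(letter list \<Rightarrow> letter list) \<Rightarrow> bool" where
  "nielsen_reduced \<phi> \<longleftrightarrow>
     (\<forall>p q. p \<noteq> q \<longrightarrow> 2 * lcp (\<phi> [p]) (\<phi> [q]) \<le> length (\<phi> [p])) \<and>
     (\<forall>p q r. p \<noteq> q \<longrightarrow> r \<noteq> flip q \<longrightarrow>
        lcp (\<phi> [p]) (\<phi> [q]) + lcp (\<phi> [flip q]) (\<phi> [r]) < length (\<phi> [q]))"

text \<open>The third conclusion drives the induction: the prefix of \<open>\<phi> [q]\<close> that can meet cancellation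
  from the left survives in \<open>\<phi> (q # w)\<close>, because the part lost to \<open>\<phi> w\<close> on the right does not reach
  that far. Hence the next letter on the left sees only \<open>\<phi> [q]\<close>.\<close>

lemma nielsen_reduced_Cons:
  assumes \<phi>: "\<phi> \<in> hom F2 F2" and nr: "nielsen_reduced \<phi>" and red: "reduced (q # w)"
  shows "length (\<phi> [q]) \<le> length (\<phi> (q # w)) \<and> length (\<phi> w) \<le> length (\<phi> (q # w)) \<and>
    (\<forall>p. p \<noteq> q \<longrightarrow> lcp (\<phi> [p]) (\<phi> (q # w)) = lcp (\<phi> [p]) (\<phi> [q]))"
  using red
proof (induction w arbitrary: q)
  case Nil
  then show ?case by (simp add: end_one[OF \<phi>])
next
  case (Cons r w)
  have rq: "r \<noteq> flip q" and red_w: "reduced (r # w)" using Cons.prems by auto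
  let ?u = "\<phi> [q]" and ?v = "\<phi> (r # w)"
  have closed: "?u \<in> carrier F2" "?v \<in> carrier F2"
    using hom_in_carrier[OF \<phi>] red_w by (simp_all add: carrier_F2)
  have eq: "\<phi> (q # r # w) = ?u \<cdot> ?v"
    by (rule end_Cons[OF \<phi> Cons.prems])
  have d: "lcp (\<phi> [flip q]) ?v = lcp (\<phi> [flip q]) (\<phi> [r])" and len_r: "length (\<phi> [r]) \<le> length ?v"
    using Cons.IH[OF red_w] rq[symmetric] by blast+
  have len: "length (?u \<cdot> ?v) + 2 * lcp (\<phi> [flip q]) (\<phi> [r]) = length ?u + length ?v"
    using length_mult[OF closed] d by (simp add: end_flip[OF \<phi>])
  have N1: "2 * lcp (\<phi> [flip q]) (\<phi> [r]) \<le> length ?u" "2 * lcp (\<phi> [flip q]) (\<phi> [r]) \<le> length (\<phi> [r])"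
    using nr rq length_end_flip[OF \<phi>, of q] lcp_commute[of "\<phi> [flip q]" "\<phi> [r]"]
    unfolding nielsen_reduced_def by metis+
  have "lcp (\<phi> [p]) (?u \<cdot> ?v) = lcp (\<phi> [p]) ?u" if "p \<noteq> q" for p
  proof (rule lcp_isosceles)
    have "lcp (\<phi> [p]) ?u + lcp (\<phi> [flip q]) (\<phi> [r]) < length ?u"
      using nr that rq unfolding nielsen_reduced_def by blast
    then show "lcp (\<phi> [p]) ?u < lcp ?u (?u \<cdot> ?v)"
      using lcp_mult[OF closed] len by linarith
  qed
  then show ?case
    unfolding eq using len N1 len_r by auto
qed

lemma nielsen_reduced_length_ge:
  assumes \<phi>: "\<phi> \<in> hom F2 F2" and nr: "nielsen_reduced \<phi>"
  shows "reduced w \<Longrightarrow> q \<in> set w \<Longrightarrow> length (\<phi> [q]) \<le> length (\<phi> w)"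
proof (induction w)
  case (Cons a w)
  have "reduced w" using Cons.prems(1) by (rule reduced_ConsD)
  then show ?case
    using nielsen_reduced_Cons[OF \<phi> nr Cons.prems(1)] Cons.IH Cons.prems(2) by fastforce
qed simp

lemma nielsen_reduced_letter_nonempty: "nielsen_reduced \<phi> \<Longrightarrow> \<phi> [q] \<noteq> []"
  unfolding nielsen_reduced_def by (metis flip_neq(1) length_0_conv not_less_zero)

lemma nielsen_reduced_inj:
  assumes \<phi>: "\<phi> \<in> hom F2 F2" and nr: "nielsen_reduced \<phi>"
  shows "inj_on \<phi> (carrier F2)"
proof -
  have "w = []" if "w \<in> carrier F2" "\<phi> w = []" for w
  proof (rule ccontr)
    assume "w \<noteq> []"
    then have "length (\<phi> [hd w]) \<le> length (\<phi> w)"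
      using that nielsen_reduced_length_ge[OF \<phi> nr, of w "hd w"] by (simp add: carrier_F2)
    with that nielsen_reduced_letter_nonempty[OF nr] show False by simp
  qed
  then show ?thesis
    using group_hom.inj_on_one_iff[OF end_group_hom[OF \<phi>]] by (simp add: one_F2)
qed

text \<open>Every subgroup of \<open>F2\<close> generated by two commuting elements is cyclic, so these are the
  endomorphisms of rank at most one, for which no Nielsen reduced pair exists.\<close>

definition abelian_image :: "(letter list \<Rightarrow> letter list) \<Rightarrow> bool" where
  "abelian_image \<phi> \<longleftrightarrow> (\<forall>u\<in>carrier F2. \<forall>v\<in>carrier F2. \<phi> u \<cdot> \<phi> v = \<phi> v \<cdot> \<phi> u)"

lemma commute_inv:
  assumes "z \<in> carrier F2" "u \<in> carrier F2" "z \<cdot> u = u \<cdot> z"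
  shows "z \<cdot> inv\<^bsub>F2\<^esub> u = inv\<^bsub>F2\<^esub> u \<cdot> z"
proof -
  have "inv\<^bsub>F2\<^esub> u \<cdot> z = inv\<^bsub>F2\<^esub> u \<cdot> (z \<cdot> u) \<cdot> inv\<^bsub>F2\<^esub> u"
    using assms(1,2) by (simp add: F2.m_assoc)
  also have "\<dots> = inv\<^bsub>F2\<^esub> u \<cdot> (u \<cdot> z) \<cdot> inv\<^bsub>F2\<^esub> u"
    using assms(3) by simp
  also have "\<dots> = z \<cdot> inv\<^bsub>F2\<^esub> u"
    using assms(1,2) by (simp add: F2.m_assoc[symmetric])
  finally show ?thesis ..
qed

lemma commute_image:
  assumes \<phi>: "\<phi> \<in> hom F2 F2" and z: "z \<in> carrier F2"
    and "fst p \<noteq> fst q" and p: "z \<cdot> \<phi> [p] = \<phi> [p] \<cdot> z" and q: "z \<cdot> \<phi> [q] = \<phi> [q] \<cdot> z"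
    and "w \<in> carrier F2"
  shows "z \<cdot> \<phi> w = \<phi> w \<cdot> z"
proof -
  have closed: "\<phi> [r] \<in> carrier F2" for r
    by (rule hom_in_carrier[OF \<phi> letter_closed])
  have letters: "z \<cdot> \<phi> [r] = \<phi> [r] \<cdot> z" for r
  proof -
    have "r \<in> {p, flip p, q, flip q}"
      using \<open>fst p \<noteq> fst q\<close>
      by (cases "fst p"; cases "fst q"; cases "fst r") (auto simp: flip_def prod_eq_iff)
    then show ?thesis
      using p q commute_inv[OF z closed p] commute_inv[OF z closed q]
        end_flip[OF \<phi>, of p] end_flip[OF \<phi>, of q] by auto
  qed
  have "reduced w \<Longrightarrow> z \<cdot> \<phi> w = \<phi> w \<cdot> z"
  proof (induction w)
    case Nil
    then show ?case using z end_one[OF \<phi>] one_F2 by (metis F2.l_one F2.r_one)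
  next
    case (Cons a w)
    have w: "reduced w" using Cons.prems by (rule reduced_ConsD)
    then have cw: "\<phi> w \<in> carrier F2" by (intro hom_in_carrier[OF \<phi>]) (simp add: carrier_F2)
    have "z \<cdot> (\<phi> [a] \<cdot> \<phi> w) = \<phi> [a] \<cdot> (z \<cdot> \<phi> w)"
      using letters[of a] closed[of a] cw z by (metis F2.m_assoc)
    also have "\<dots> = \<phi> [a] \<cdot> \<phi> w \<cdot> z"
      using Cons.IH[OF w] closed[of a] cw z by (simp add: F2.m_assoc)
    finally show ?case using end_Cons[OF \<phi> Cons.prems] by simp
  qed
  then show ?thesis using assms(6) by (simp add: carrier_F2)
qed

lemma abelian_imageI:
  assumes \<phi>: "\<phi> \<in> hom F2 F2" and pq: "fst p \<noteq> fst q" and comm: "\<phi> [p] \<cdot> \<phi> [q] = \<phi> [q] \<cdot> \<phi> [p]"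
  shows "abelian_image \<phi>"
proof -
  have closed: "\<phi> [r] \<in> carrier F2" for r
    by (rule hom_in_carrier[OF \<phi> letter_closed])
  have p: "\<phi> [p] \<cdot> \<phi> w = \<phi> w \<cdot> \<phi> [p]" if "w \<in> carrier F2" for w
    using commute_image[OF \<phi> closed pq refl comm that] .
  have q: "\<phi> [q] \<cdot> \<phi> w = \<phi> w \<cdot> \<phi> [q]" if "w \<in> carrier F2" for w
    using commute_image[OF \<phi> closed pq comm[symmetric] refl that] .
  have "\<phi> u \<cdot> \<phi> w = \<phi> w \<cdot> \<phi> u" if "u \<in> carrier F2" "w \<in> carrier F2" for u w
    using commute_image[OF \<phi> hom_in_carrier[OF \<phi> that(1)] pq p[OF that(1), symmetric]
        q[OF that(1), symmetric] that(2)] .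
  then show ?thesis by (simp add: abelian_image_def)
qed

lemma abelian_image_if_letter_trivial:
  assumes \<phi>: "\<phi> \<in> hom F2 F2" and "\<phi> [p] = []"
  shows "abelian_image \<phi>"
proof -
  let ?q = "(if fst p = GenX then GenY else GenX, True)"
  have "\<phi> [?q] \<in> carrier F2" by (rule hom_in_carrier[OF \<phi> letter_closed])
  then have "\<phi> [p] \<cdot> \<phi> [?q] = \<phi> [?q] \<cdot> \<phi> [p]"
    using assms(2) one_F2 by (metis F2.l_one F2.r_one)
  then show ?thesis by (intro abelian_imageI[OF \<phi>, of p ?q]) auto
qed

lemma abelian_image_comp_iso:
  assumes "\<alpha> \<in> iso F2 F2" "abelian_image (\<phi> \<circ> \<alpha>)"
  shows "abelian_image \<phi>"
proof -
  have surj: "\<alpha> ` carrier F2 = carrier F2"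
    using assms(1) by (simp add: iso_iff)
  have "\<forall>u\<in>\<alpha> ` carrier F2. \<forall>v\<in>\<alpha> ` carrier F2. \<phi> u \<cdot> \<phi> v = \<phi> v \<cdot> \<phi> u"
    using assms(2) by (simp add: abelian_image_def)
  then show ?thesis unfolding surj abelian_image_def .
qed

definition total_length :: "(letter list \<Rightarrow> letter list) \<Rightarrow> nat" where
  "total_length \<phi> = length (\<phi> F2_x) + length (\<phi> F2_y)"

text \<open>Minimality is taken over the whole orbit under composition with automorphisms, so that it
  passes to any other map of the orbit with the same total length.\<close>

definition minimal :: "(letter list \<Rightarrow> letter list) \<Rightarrow> bool" where
  "minimal \<phi> \<longleftrightarrow> (\<forall>\<alpha>\<in>iso F2 F2. total_length \<phi> \<le> total_length (\<phi> \<circ> \<alpha>))"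

lemma total_length_letters:
  assumes "\<phi> \<in> hom F2 F2" "fst p \<noteq> fst q"
  shows "total_length \<phi> = length (\<phi> [p]) + length (\<phi> [q])"
proof -
  have "length (\<phi> [(fst r, True)]) = length (\<phi> [r])" for r
    using length_end_flip[OF assms(1), of "(fst r, True)"]
    by (cases r; cases "snd r") (simp_all add: flip_def)
  from this[of p] this[of q] show ?thesis
    using assms(2) by (cases "fst p"; cases "fst q") (simp_all add: total_length_def)
qed

text \<open>For letters on different generators, more cancellation would let a Nielsen move shorten the
  pair.\<close>

lemma minimal_lcp_le:
  assumes \<phi>: "\<phi> \<in> hom F2 F2" and min: "minimal \<phi>" and nc: "\<not> abelian_image \<phi>" and "p \<noteq> q"
  shows "2 * lcp (\<phi> [p]) (\<phi> [q]) \<le> length (\<phi> [p])"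
proof (cases "fst p = fst q")
  case True
  with \<open>p \<noteq> q\<close> have "q = flip p" by (auto simp: flip_def prod_eq_iff)
  moreover have "\<phi> [p] \<noteq> []" using abelian_image_if_letter_trivial[OF \<phi>] nc by blast
  ultimately show ?thesis
    using lcp_inv_less[OF hom_in_carrier[OF \<phi> letter_closed], of p] by (simp add: end_flip[OF \<phi>])
next
  case False
  note hom = nielsen_move_hom[OF False] and letters = nielsen_move_letters[OF False]
  have "total_length \<phi> \<le> total_length (\<phi> \<circ> nielsen_move p q)"
    using min nielsen_move_iso[OF False] by (simp add: minimal_def)
  moreover have "total_length \<phi> = length (\<phi> [p]) + length (\<phi> [q])"
    using total_length_letters[OF \<phi> False] .
  moreover have "total_length (\<phi> \<circ> nielsen_move p q) = length (\<phi> [p]) + length (\<phi> [flip p, q])"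
    using total_length_letters[OF end_comp[OF \<phi> hom] False] by (simp add: letters)
  moreover have "\<phi> [flip p, q] = inv\<^bsub>F2\<^esub> (\<phi> [p]) \<cdot> \<phi> [q]"
    using end_Cons[OF \<phi>, of "flip p" "[q]"] False by (auto simp: end_flip[OF \<phi>])
  ultimately show ?thesis
    using length_inv_mult[of "\<phi> [p]" "\<phi> [q]"] hom_in_carrier[OF \<phi> letter_closed] by simp
qed

text \<open>The way in which a minimal pair can fail to be Nielsen reduced: \<open>\<phi> [q] = u v\<^sup>-\<^sup>1\<close> with \<open>u\<close> and \<open>v\<close> of
  equal length, where \<open>\<phi> [p]\<close> starts with \<open>u\<close> and its inverse starts with \<open>v\<close>, so that nothing of
  \<open>\<phi> [q]\<close> need remain between two copies of \<open>\<phi> [flip p]\<close>.\<close>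

definition absorbed :: "(letter list \<Rightarrow> letter list) \<Rightarrow> letter \<Rightarrow> letter \<Rightarrow> bool" where
  "absorbed \<phi> p q \<longleftrightarrow> fst p \<noteq> fst q \<and> 2 * lcp (\<phi> [p]) (\<phi> [q]) = length (\<phi> [q]) \<and>
     2 * lcp (\<phi> [flip p]) (\<phi> [flip q]) = length (\<phi> [q])"

text \<open>By minimality each neighbour cancels at most half of \<open>\<phi> [q]\<close>, so it can vanish only if both
  cancel exactly half. No neighbour is on the generator of \<open>q\<close>, as less than half of \<open>\<phi> [q]\<close> cancels
  in its square, and for the same reason the two neighbours are equal as letters.\<close>

lemma minimal_nielsen_reduced:
  assumes \<phi>: "\<phi> \<in> hom F2 F2" and min: "minimal \<phi>" and nc: "\<not> abelian_image \<phi>"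
    and no: "\<And>p q. \<not> absorbed \<phi> p q"
  shows "nielsen_reduced \<phi>"
  unfolding nielsen_reduced_def
proof (intro conjI allI impI)
  fix p q r
  assume pq: "p \<noteq> q" and rq: "r \<noteq> flip q"
  note N1 = minimal_lcp_le[OF \<phi> min nc]
  show "lcp (\<phi> [p]) (\<phi> [q]) + lcp (\<phi> [flip q]) (\<phi> [r]) < length (\<phi> [q])"
  proof (rule ccontr)
    assume "\<not> ?thesis"
    then have half: "2 * lcp (\<phi> [p]) (\<phi> [q]) = length (\<phi> [q])"
        "2 * lcp (\<phi> [r]) (\<phi> [flip q]) = length (\<phi> [q])"
      using N1[of q p] N1[of "flip q" r] pq rq length_end_flip[OF \<phi>, of q]
        lcp_commute[of "\<phi> [q]" "\<phi> [p]"] lcp_commute[of "\<phi> [r]" "\<phi> [flip q]"] by auto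
    have less: "2 * lcp (\<phi> [q]) (\<phi> [flip q]) < length (\<phi> [q])"
      using lcp_inv_less[OF hom_in_carrier[OF \<phi> letter_closed], of q]
        abelian_image_if_letter_trivial[OF \<phi>, of q] nc by (auto simp: end_flip[OF \<phi>])
    have "p \<noteq> flip q" "r \<noteq> q"
      using half less by (auto simp: lcp_commute)
    then have gens: "fst p \<noteq> fst q" "fst r \<noteq> fst q"
      using pq rq by (auto simp: flip_def prod_eq_iff)
    have "p \<noteq> r"
      using half less lcp_ultrametric[of "\<phi> [q]" "\<phi> [p]" "\<phi> [flip q]"]
        lcp_commute[of "\<phi> [q]" "\<phi> [p]"] by auto
    then have "r = flip p"
      using gens by (cases "fst p"; cases "fst q"; cases "fst r") (auto simp: flip_def prod_eq_iff)
    with half gens no[of p q] show False by (simp add: absorbed_def)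
  qed
qed (rule minimal_lcp_le[OF \<phi> min nc])

text \<open>If \<open>\<phi> [q] = u v\<^sup>-\<^sup>1\<close> is absorbed by \<open>\<phi> [p] = u m v\<^sup>-\<^sup>1\<close>, the move replaces \<open>\<phi> [p]\<close> by \<open>v m v\<^sup>-\<^sup>1\<close>, which
  has the same length. Now the new word and its inverse both start with \<open>v\<close>, as does the inverse of
  \<open>\<phi> [q]\<close> (\<open>near\<close> in the proof). A further absorption would then force half of one of the two words
  to cancel in its square.\<close>

lemma absorbed_move:
  assumes \<phi>: "\<phi> \<in> hom F2 F2" and min: "minimal \<phi>" and nc: "\<not> abelian_image \<phi>"
    and abs: "absorbed \<phi> p q"
  defines "\<psi> \<equiv> \<phi> \<circ> nielsen_move q p"
  shows "minimal \<psi>" "\<not> absorbed \<psi> s t"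
proof -
  have pq: "fst p \<noteq> fst q" and half1: "2 * lcp (\<phi> [p]) (\<phi> [q]) = length (\<phi> [q])"
    and half2: "2 * lcp (\<phi> [flip p]) (\<phi> [flip q]) = length (\<phi> [q])"
    using abs by (auto simp: absorbed_def)
  have qp: "fst q \<noteq> fst p" using pq by simp
  have \<psi>: "\<psi> \<in> hom F2 F2"
    unfolding \<psi>_def by (rule end_comp[OF \<phi> nielsen_move_hom[OF qp]])
  have nc': "\<not> abelian_image \<psi>"
    using nc abelian_image_comp_iso[OF nielsen_move_iso[OF qp]] unfolding \<psi>_def by blast
  define e l where "e = \<phi> [p]" and "l = \<phi> [q]"
  have closed: "e \<in> carrier F2" "l \<in> carrier F2"
    unfolding e_def l_def by (rule hom_in_carrier[OF \<phi> letter_closed])+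
  have \<psi>q: "\<psi> [q] = l"
    by (simp add: \<psi>_def nielsen_move_letters[OF qp] l_def)
  have \<psi>p: "\<psi> [p] = inv\<^bsub>F2\<^esub> l \<cdot> e"
    using end_Cons[OF \<phi>, of "flip q" "[p]"] qp
    by (auto simp: \<psi>_def nielsen_move_letters[OF qp] l_def e_def end_flip[OF \<phi>])
  have half: "2 * lcp l e = length l" "2 * lcp (inv\<^bsub>F2\<^esub> l) (inv\<^bsub>F2\<^esub> e) = length l"
    using half1 half2 lcp_commute[of e l] lcp_commute[of "inv\<^bsub>F2\<^esub> e" "inv\<^bsub>F2\<^esub> l"]
    by (simp_all add: e_def l_def end_flip[OF \<phi>])
  have len: "length (\<psi> [p]) = length e"
    using length_inv_mult[OF closed(2,1)] half(1) by (simp add: \<psi>p)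
  have "total_length \<psi> = total_length \<phi>"
    using total_length_letters[OF \<psi> pq] total_length_letters[OF \<phi> pq] len \<psi>q
    by (simp add: e_def l_def)
  then show min': "minimal \<psi>"
    using min iso_set_trans[OF _ nielsen_move_iso[OF qp]]
    unfolding minimal_def \<psi>_def comp_assoc by metis
  have inv_e': "inv\<^bsub>F2\<^esub> (\<psi> [p]) = inv\<^bsub>F2\<^esub> e \<cdot> l"
    using closed by (simp add: \<psi>p F2.inv_mult_group)
  have A: "length l \<le> 2 * lcp (inv\<^bsub>F2\<^esub> l) (\<psi> [p])"
    using lcp_mult[of "inv\<^bsub>F2\<^esub> l" e] closed len by (simp add: \<psi>p length_inv)
  have le: "length l \<le> length e"
    using minimal_lcp_le[OF \<phi> min nc, of p q] pq half1 by (auto simp: e_def l_def)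
  have "length l \<le> 2 * lcp (inv\<^bsub>F2\<^esub> e) (inv\<^bsub>F2\<^esub> (\<psi> [p]))"
  proof -
    have "length (inv\<^bsub>F2\<^esub> e \<cdot> l) = length e"
      using length_inv[OF hom_in_carrier[OF \<psi> letter_closed], of p] by (simp add: inv_e' len)
    then show ?thesis
      using lcp_mult[of "inv\<^bsub>F2\<^esub> e" l] closed le by (simp add: inv_e' length_inv)
  qed
  then have B: "length l \<le> 2 * lcp (inv\<^bsub>F2\<^esub> l) (inv\<^bsub>F2\<^esub> (\<psi> [p]))"
    using lcp_ultrametric[of "inv\<^bsub>F2\<^esub> l" "inv\<^bsub>F2\<^esub> e" "inv\<^bsub>F2\<^esub> (\<psi> [p])"] half(2) by linarith
  have nonempty: "\<psi> [r] \<noteq> []" for r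
    using abelian_image_if_letter_trivial[OF \<psi>] nc' by blast
  have less: "2 * lcp (\<psi> [r]) (inv\<^bsub>F2\<^esub> (\<psi> [r])) < length (\<psi> [r])" for r
    by (rule lcp_inv_less[OF hom_in_carrier[OF \<psi> letter_closed] nonempty])
  have near: "length l \<le> 2 * lcp (inv\<^bsub>F2\<^esub> l) (\<psi> [r])" if "fst r = fst p" for r
  proof -
    have "r = p \<or> r = flip p" using that by (auto simp: flip_def prod_eq_iff)
    then show ?thesis using A B by (auto simp: end_flip[OF \<psi>])
  qed
  show "\<not> absorbed \<psi> s t"
  proof
    assume st: "absorbed \<psi> s t"
    show False
    proof (cases "fst t = fst q")
      case True
      then have "t = q \<or> t = flip q" by (auto simp: flip_def prod_eq_iff)
      moreover have "fst s = fst p" "fst (flip s) = fst p"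
        using st pq True unfolding absorbed_def
        by (cases "fst s"; cases "fst p"; cases "fst q"; simp add: flip_def)+
      ultimately obtain r where r: "fst r = fst p" and "2 * lcp (\<psi> [r]) l = length l"
        using st \<psi>q length_end_flip[OF \<psi>, of q] unfolding absorbed_def by (metis flip_flip)
      then show False
        using near[OF r] lcp_ultrametric[of "inv\<^bsub>F2\<^esub> l" "\<psi> [r]" l] less[of q]
          lcp_commute[of l "inv\<^bsub>F2\<^esub> l"] by (simp add: \<psi>q)
    next
      case False
      then have t: "fst t = fst p" "fst (flip t) = fst p" and s: "fst s = fst q"
        using st pq unfolding absorbed_def
        by (cases "fst s"; cases "fst p"; cases "fst q"; cases "fst t"; simp add: flip_def)+
      have "s \<noteq> t" using s False by auto
      have "s = q \<or> s = flip q" using s by (auto simp: flip_def prod_eq_iff)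
      then have "length (\<psi> [s]) = length l"
        using length_end_flip[OF \<psi>, of q] \<psi>q by auto
      moreover have "length (\<psi> [t]) \<le> length (\<psi> [s])"
        using minimal_lcp_le[OF \<psi> min' nc' \<open>s \<noteq> t\<close>] st by (simp add: absorbed_def)
      ultimately show False
        using near[OF t(1)] near[OF t(2)] less[of t]
          lcp_ultrametric[of "\<psi> [t]" "inv\<^bsub>F2\<^esub> l" "\<psi> [flip t]"] lcp_commute[of "\<psi> [t]" "inv\<^bsub>F2\<^esub> l"]
        by (simp add: end_flip[OF \<psi>])
    qed
  qed
qed

text \<open>At minimal total length, a single further move removes every absorption.\<close>

lemma nielsen_reduction:
  assumes \<phi>: "\<phi> \<in> hom F2 F2" and nc: "\<not> abelian_image \<phi>"
  shows "\<exists>\<alpha>\<in>iso F2 F2. nielsen_reduced (\<phi> \<circ> \<alpha>)"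
proof -
  obtain \<alpha> where \<alpha>: "\<alpha> \<in> iso F2 F2"
    and least: "\<And>\<beta>. \<beta> \<in> iso F2 F2 \<Longrightarrow> total_length (\<phi> \<circ> \<alpha>) \<le> total_length (\<phi> \<circ> \<beta>)"
    using ex_has_least_nat[of "\<lambda>\<alpha>. \<alpha> \<in> iso F2 F2", OF id_iso, of "\<lambda>\<alpha>. total_length (\<phi> \<circ> \<alpha>)"]
    by metis
  let ?\<psi> = "\<phi> \<circ> \<alpha>"
  have \<psi>: "?\<psi> \<in> hom F2 F2" by (rule end_comp[OF \<phi> iso_imp_homomorphism[OF \<alpha>]])
  have nc': "\<not> abelian_image ?\<psi>" using abelian_image_comp_iso[OF \<alpha>] nc by blast
  have min: "minimal ?\<psi>"
    unfolding minimal_def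
  proof
    fix \<beta> assume "\<beta> \<in> iso F2 F2"
    then show "total_length ?\<psi> \<le> total_length (?\<psi> \<circ> \<beta>)"
      using least[OF iso_set_trans[OF _ \<alpha>]] by (simp add: comp_assoc)
  qed
  show ?thesis
  proof (cases "\<exists>p q. absorbed ?\<psi> p q")
    case False
    then show ?thesis using minimal_nielsen_reduced[OF \<psi> min nc'] \<alpha> by blast
  next
    case True
    then obtain p q where pq: "absorbed ?\<psi> p q" by blast
    then have qp: "fst q \<noteq> fst p" by (auto simp: absorbed_def)
    note move = nielsen_move_iso[OF qp]
    have "nielsen_reduced (?\<psi> \<circ> nielsen_move q p)"
    proof (rule minimal_nielsen_reduced[OF end_comp[OF \<psi> iso_imp_homomorphism[OF move]]])
      show "\<not> abelian_image (?\<psi> \<circ> nielsen_move q p)"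
        using abelian_image_comp_iso[OF move] nc' by blast
    qed (rule absorbed_move[OF \<psi> min nc' pq])+
    then show ?thesis
      using iso_set_trans[OF move \<alpha>] unfolding comp_assoc by (rule bexI)
  qed
qed

section \<open>Test words\<close>

text \<open>Membership in the commutator subgroup of \<open>F2\<close>, expressed without quotients: if the exponent
  sums of \<open>w\<close> are not both zero, some endomorphism into the powers of one generator detects this.
  In this form the property is clearly invariant under automorphisms.\<close>

definition commutator_word :: "letter list \<Rightarrow> bool" where
  "commutator_word w \<longleftrightarrow> (\<forall>\<theta>\<in>hom F2 F2. abelian_image \<theta> \<longrightarrow> \<theta> w = [])"

text \<open>The length of \<open>w\<close> bounds the images of the generators under all the reduced maps \<open>\<psi> k\<close>, so two
  of these maps coincide.\<close>

lemma iso_if_fixes_word: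
  assumes w: "w \<in> carrier F2" "w \<noteq> []"
    and comm: "commutator_word w"
    and \<phi>: "\<phi> \<in> hom F2 F2" and fixed: "\<phi> w = w"
  shows "\<phi> \<in> iso F2 F2"
proof -
  have triv: "\<theta> w = []" if "\<theta> \<in> hom F2 F2" "abelian_image \<theta>" for \<theta>
    using comm that by (simp add: commutator_word_def)
  have pow: "\<phi> ^^ k \<in> hom F2 F2" for k
  proof (induction k)
    case 0
    show ?case by (simp add: hom_def)
  next
    case (Suc k)
    then show ?case using end_comp[OF \<phi>, of "\<phi> ^^ k"] by (simp only: funpow.simps)
  qed
  have pow_w: "(\<phi> ^^ k) w = w" for k
    by (induction k) (simp_all add: fixed)
  have "\<exists>\<alpha>\<in>iso F2 F2. nielsen_reduced (\<phi> ^^ k \<circ> \<alpha>)" for k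
    using nielsen_reduction[OF pow] triv[OF pow] pow_w w(2) by metis
  then obtain \<alpha> where \<alpha>: "\<And>k. \<alpha> k \<in> iso F2 F2" and nr: "\<And>k. nielsen_reduced (\<phi> ^^ k \<circ> \<alpha> k)"
    by metis
  define \<psi> where "\<psi> k = \<phi> ^^ k \<circ> \<alpha> k" for k
  have \<psi>: "\<psi> k \<in> hom F2 F2" for k
    unfolding \<psi>_def by (rule end_comp[OF pow iso_imp_homomorphism[OF \<alpha>]])
  have bound: "length (\<psi> k [(g, True)]) \<le> length w" for k g
  proof -
    define v where "v = inv_into (carrier F2) (\<alpha> k) w"
    have \<alpha>w: "\<alpha> k v = w" "v \<in> carrier F2"
      using \<alpha>[of k] w(1) unfolding v_def iso_iff by (metis f_inv_into_f, metis inv_into_into)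
    have "\<exists>s. (g, s) \<in> set v"
    proof (rule ccontr)
      assume no: "\<not> ?thesis"
      \<comment> \<open>Killing the generator that does not occur in \<open>v\<close> leaves \<open>v\<close> unchanged.\<close>
      define \<theta> where
        "\<theta> u = word_map F2 u (if g = GenX then [] else F2_x) (if g = GenY then [] else F2_y)" for u
      have \<theta>: "\<theta> \<in> hom F2 F2"
        unfolding \<theta>_def by (intro word_map_hom[OF group_F2]) (simp_all add: carrier_F2)
      have "\<theta> [(g, True)] = []"
        unfolding \<theta>_def
        by (cases g) (simp_all add: word_map_generators[OF group_F2] carrier_F2)
      then have com: "abelian_image \<theta>" by (rule abelian_image_if_letter_trivial[OF \<theta>])
      have "\<theta> v = word_map F2 v F2_x F2_y"
        unfolding \<theta>_def word_map_def
        by (rule foldr_cong) (use no in \<open>auto simp: letter_val_def Let_def split: gen.split\<close>)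
      then have \<theta>v: "\<theta> v = v" using word_map_F2[OF \<alpha>w(2)] by simp
      let ?\<eta> = "\<theta> \<circ> inv_into (carrier F2) (\<alpha> k)"
      have inv: "inv_into (carrier F2) (\<alpha> k) \<in> iso F2 F2" by (rule F2.iso_set_sym[OF \<alpha>])
      have "?\<eta> \<in> hom F2 F2" by (rule end_comp[OF \<theta> iso_imp_homomorphism[OF inv]])
      moreover have "abelian_image ?\<eta>"
        using com hom_in_carrier[OF iso_imp_homomorphism[OF inv]] by (simp add: abelian_image_def)
      ultimately have "v = []" using triv[of ?\<eta>] \<theta>v by (simp add: v_def)
      then have "w = []" using \<alpha>w(1) end_one[OF iso_imp_homomorphism[OF \<alpha>]] by simp
      with w(2) show False by simp
    qed
    then obtain s where "(g, s) \<in> set v" ..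
    then have "length (\<psi> k [(g, s)]) \<le> length (\<psi> k v)"
      using nielsen_reduced_length_ge[OF \<psi> nr[folded \<psi>_def]] \<alpha>w(2) by (simp add: carrier_F2)
    moreover have "\<psi> k v = w" by (simp add: \<psi>_def \<alpha>w(1) pow_w)
    moreover have "length (\<psi> k [(g, True)]) = length (\<psi> k [(g, s)])"
      using length_end_flip[OF \<psi>, of k "(g, True)"] by (cases s) (simp_all add: flip_def)
    ultimately show ?thesis by simp
  qed
  have "\<not> inj (\<lambda>k. (\<psi> k F2_x, \<psi> k F2_y))"
  proof
    let ?f = "\<lambda>k. (\<psi> k F2_x, \<psi> k F2_y)" and ?B = "{u :: letter list. length u \<le> length w}"
    assume inj: "inj ?f"
    have "finite (UNIV :: gen set)"
      by (rule finite_subset[of _ "{GenX, GenY}"]) (use gen.exhaust in auto)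
    then have "finite (UNIV :: letter set)" by (simp add: finite_prod)
    then have "finite ?B"
      using finite_lists_length_le[of "UNIV :: letter set" "length w"] by simp
    then have "finite (?B \<times> ?B)" by (intro finite_cartesian_product)
    moreover have "range ?f \<subseteq> ?B \<times> ?B"
      using bound by blast
    ultimately have "finite (range ?f)" by (rule finite_subset[rotated])
    then show False using inj finite_imageD infinite_UNIV_nat by blast
  qed
  then obtain i j where ij: "i < j" and eq: "\<psi> i F2_x = \<psi> j F2_x" "\<psi> i F2_y = \<psi> j F2_y"
    unfolding inj_def by (metis (no_types, lifting) linorder_neqE_nat Pair_inject)
  have inj: "inj_on (\<phi> ^^ k) (carrier F2)" for k
  proof -
    have "inj_on (\<phi> ^^ k \<circ> \<alpha> k) (carrier F2)"
      using nielsen_reduced_inj[OF \<psi> nr[folded \<psi>_def], of k] by (simp add: \<psi>_def)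
    moreover have "\<alpha> k ` carrier F2 = carrier F2" using \<alpha>[of k] by (simp add: iso_iff)
    ultimately show ?thesis by (metis inj_on_imageI)
  qed
  have "\<phi> ` carrier F2 = carrier F2"
  proof
    show "\<phi> ` carrier F2 \<subseteq> carrier F2" using hom_in_carrier[OF \<phi>] by blast
    show "carrier F2 \<subseteq> \<phi> ` carrier F2"
    proof
      fix u assume "u \<in> carrier F2"
      then obtain z where z: "z \<in> carrier F2" and u: "u = \<alpha> i z"
        using \<alpha>[of i] unfolding iso_iff by blast
      obtain d where j: "j = i + Suc d" using ij less_iff_Suc_add by auto
      have zj: "\<alpha> j z \<in> carrier F2" by (rule hom_in_carrier[OF iso_imp_homomorphism[OF \<alpha>] z])
      have "\<psi> i z = \<psi> j z" by (rule end_eqI[OF \<psi> \<psi> eq z])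
      then have "(\<phi> ^^ i) u = (\<phi> ^^ i) ((\<phi> ^^ Suc d) (\<alpha> j z))"
        by (simp only: \<psi>_def u j funpow_add comp_apply)
      then have "u = (\<phi> ^^ Suc d) (\<alpha> j z)"
        using inj_onD[OF inj] \<open>u \<in> carrier F2\<close> hom_in_carrier[OF pow zj] by blast
      then show "u \<in> \<phi> ` carrier F2"
        using hom_in_carrier[OF pow zj, of d] by simp
    qed
  qed
  then show ?thesis using \<phi> inj[of 1] by (simp add: iso_iff)
qed

text \<open>The square of \<open>\<phi>\<close> fixes \<open>w\<close>.\<close>

lemma iso_if_inverts_word:
  assumes w: "w \<in> carrier F2" "w \<noteq> []"
    and comm: "commutator_word w"
    and \<phi>: "\<phi> \<in> hom F2 F2" and inverts: "\<phi> w = inv\<^bsub>F2\<^esub> w"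
  shows "\<phi> \<in> iso F2 F2"
proof -
  have "(\<phi> \<circ> \<phi>) w = w"
    using end_inv[OF \<phi> w(1)] inverts w(1) by simp
  then have "\<phi> \<circ> \<phi> \<in> iso F2 F2"
    by (rule iso_if_fixes_word[OF w comm end_comp[OF \<phi> \<phi>]])
  then have inj: "inj_on (\<phi> \<circ> \<phi>) (carrier F2)" and surj: "\<phi> ` \<phi> ` carrier F2 = carrier F2"
    by (auto simp: iso_iff image_comp)
  have "\<phi> ` carrier F2 \<subseteq> carrier F2" using hom_in_carrier[OF \<phi>] by blast
  then have "\<phi> ` carrier F2 = carrier F2" using surj by (metis image_mono subset_antisym)
  then show ?thesis using \<phi> inj_on_imageI2[OF inj] by (simp add: iso_iff)
qed

section \<open>Engel words\<close>

lemma commutator_closed: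
  "group G \<Longrightarrow> a \<in> carrier G \<Longrightarrow> b \<in> carrier G \<Longrightarrow> commutator G a b \<in> carrier G"
  by (simp add: commutator_def group.is_monoid monoid.m_closed)

lemma engel_closed:
  "group G \<Longrightarrow> a \<in> carrier G \<Longrightarrow> b \<in> carrier G \<Longrightarrow> engel G a n b \<in> carrier G"
  by (induction n) (simp_all add: commutator_closed)

lemma hom_engel:
  assumes "group G" "group H" "\<phi> \<in> hom G H" "a \<in> carrier G" "b \<in> carrier G"
  shows "\<phi> (engel G a n b) = engel H (\<phi> a) n (\<phi> b)"
proof (induction n)
  case (Suc n)
  interpret group_hom G H \<phi> using assms by (simp add: group_hom_def group_hom_axioms_def)
  show ?case using engel_closed[OF assms(1,4,5)] assms(4,5) Suc by (simp add: commutator_def)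
qed simp

lemma engel_word_closed: "engel_word n \<in> carrier F2"
  unfolding engel_word_def by (rule engel_closed[OF group_F2 F2_generators])

lemma commutator_word_engel_word: "commutator_word (engel_word (Suc n))"
  unfolding commutator_word_def
proof (intro ballI impI)
  fix \<theta> assume \<theta>: "\<theta> \<in> hom F2 F2" and comm: "abelian_image \<theta>"
  have closed: "\<theta> (engel_word n) \<in> carrier F2" "\<theta> F2_y \<in> carrier F2"
    using hom_in_carrier[OF \<theta>] engel_word_closed F2_generators by auto
  have "\<theta> (engel_word (Suc n)) = commutator F2 (\<theta> (engel_word n)) (\<theta> F2_y)"
    using hom_mult[OF \<theta>] end_inv[OF \<theta>] engel_word_closed[of n] F2_generators(2)
    by (simp add: engel_word_def commutator_def)
  moreover have "\<theta> (engel_word n) \<cdot> \<theta> F2_y = \<theta> F2_y \<cdot> \<theta> (engel_word n)"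
    using comm engel_word_closed F2_generators(2) by (simp add: abelian_image_def)
  ultimately have "\<theta> (engel_word (Suc n)) = \<one>\<^bsub>F2\<^esub>"
    using closed by (simp add: commutator_def F2.m_assoc)
  then show "\<theta> (engel_word (Suc n)) = []" by (simp only: one_F2)
qed

text \<open>The infinite dihedral group: \<open>(a, s)\<close> is the map \<open>t \<mapsto> a \<plusminus> t\<close> on the integers, with the minus sign
  if \<open>s\<close> is true. It is a convenient witness that Engel words are nontrivial, since taking the
  commutator with a reflection doubles a translation.\<close>

definition dihedral :: "(int \<times> bool) monoid" where
  "dihedral = \<lparr>carrier = UNIV,
     mult = \<lambda>(a, s) (b, t). (if s then a - b else a + b, s \<noteq> t), one = (0, False)\<rparr>"

lemma group_dihedral: "group dihedral"
proof (rule groupI)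
  fix a assume "a \<in> carrier dihedral"
  show "\<exists>b\<in>carrier dihedral. b \<otimes>\<^bsub>dihedral\<^esub> a = \<one>\<^bsub>dihedral\<^esub>"
    by (intro bexI[of _ "(if snd a then fst a else - fst a, snd a)"])
      (auto simp: dihedral_def split: prod.split)
qed (auto simp: dihedral_def split: prod.split)

lemma engel_dihedral: "engel dihedral (1, False) n (0, True) = (2 ^ n, False)"
proof (induction n)
  case (Suc n)
  interpret group dihedral by (rule group_dihedral)
  have "inv\<^bsub>dihedral\<^esub> (2 ^ n, False) = (- (2 ^ n), False)" "inv\<^bsub>dihedral\<^esub> (0, True) = (0, True)"
    by (rule inv_equality; simp add: dihedral_def)+
  then show ?case by (simp add: commutator_def Suc) (simp add: dihedral_def)
qed simp

lemma engel_word_nontrivial: "engel_word n \<noteq> []"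
proof
  assume "engel_word n = []"
  let ?\<theta> = "\<lambda>w. word_map dihedral w (1, False) (0, True)"
  have car: "(1, False) \<in> carrier dihedral" "(0, True) \<in> carrier dihedral"
    by (simp_all add: dihedral_def)
  have "?\<theta> (engel_word n) = (2 ^ n, False)"
    using hom_engel[OF group_F2 group_dihedral word_map_hom[OF group_dihedral car] F2_generators]
    by (simp add: engel_word_def word_map_generators[OF group_dihedral car] engel_dihedral)
  moreover have "?\<theta> [] = (0, False)" by (simp add: word_map_Nil dihedral_def)
  ultimately show False using \<open>engel_word n = []\<close> by simp
qed

lemma word_image_end_subset:
  assumes G: "group G" and \<sigma>: "\<sigma> \<in> hom F2 F2" and w: "w \<in> carrier F2"
  shows "word_image G (\<sigma> w) \<subseteq> word_image G w"
proof
  fix z assume "z \<in> word_image G (\<sigma> w)"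
  then obtain g h where gh: "g \<in> carrier G" "h \<in> carrier G" and z: "z = word_map G (\<sigma> w) g h"
    by (auto simp: word_image_def)
  have "z = word_map G w (word_map G (\<sigma> F2_x) g h) (word_map G (\<sigma> F2_y) g h)"
    unfolding z end_eq_word_map[OF \<sigma> w]
    by (rule hom_word_map[OF group_F2 G word_map_hom[OF G gh]])
      (rule hom_in_carrier[OF \<sigma>], rule F2_generators)+
  then show "z \<in> word_image G w"
    using word_map_closed[OF G gh] by (auto simp: word_image_def)
qed

theorem mainTheorem2:
  fixes n :: nat
  assumes "n \<ge> 1"
  shows "achiral TYPE('g::infinite) (engel_word n) \<longleftrightarrow>
         (\<exists>\<sigma> \<in> iso F2 F2. \<sigma> (engel_word n) = inv\<^bsub>F2\<^esub> (engel_word n))"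
proof
  let ?e = "engel_word n"
  have e: "?e \<in> carrier F2" by (rule engel_word_closed)
  assume "achiral TYPE('g) ?e"
  then have "word_image F2 ?e = word_image F2 (inv\<^bsub>F2\<^esub> ?e)"
    by (rule achiral_imp_word_image_eq[OF _ e group_F2])
  moreover have "word_map F2 (inv\<^bsub>F2\<^esub> ?e) F2_x F2_y \<in> word_image F2 (inv\<^bsub>F2\<^esub> ?e)"
    using F2_generators unfolding word_image_def by blast
  ultimately have "inv\<^bsub>F2\<^esub> ?e \<in> word_image F2 ?e"
    by (simp only: word_map_F2[OF F2.inv_closed[OF e]])
  then obtain u v where uv: "u \<in> carrier F2" "v \<in> carrier F2"
    and inverts: "word_map F2 ?e u v = inv\<^bsub>F2\<^esub> ?e"
    unfolding word_image_def by (elim CollectE exE conjE) (rule that, assumption+, rule sym)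
  obtain m where "n = Suc m" using assms by (cases n) auto
  then have comm: "commutator_word ?e" by (simp add: commutator_word_engel_word)
  define \<phi> where "\<phi> w = word_map F2 w u v" for w
  have "\<phi> \<in> hom F2 F2" "\<phi> ?e = inv\<^bsub>F2\<^esub> ?e"
    unfolding \<phi>_def by (rule word_map_hom[OF group_F2 uv], rule inverts)
  then show "\<exists>\<sigma>\<in>iso F2 F2. \<sigma> ?e = inv\<^bsub>F2\<^esub> ?e"
    using iso_if_inverts_word[OF e engel_word_nontrivial comm, of \<phi>] by blast
next
  let ?e = "engel_word n"
  have e: "?e \<in> carrier F2" by (rule engel_word_closed)
  assume "\<exists>\<sigma>\<in>iso F2 F2. \<sigma> ?e = inv\<^bsub>F2\<^esub> ?e"
  then obtain \<sigma> where \<sigma>: "\<sigma> \<in> hom F2 F2" and inverts: "\<sigma> ?e = inv\<^bsub>F2\<^esub> ?e"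
    using iso_imp_homomorphism by blast
  have "\<sigma> (inv\<^bsub>F2\<^esub> ?e) = ?e" using end_inv[OF \<sigma> e] inverts e by simp
  then show "achiral TYPE('g) ?e"
    unfolding achiral_def
    using word_image_end_subset[OF _ \<sigma> e] word_image_end_subset[OF _ \<sigma> F2.inv_closed[OF e]] inverts
    by (metis subset_antisym)
qed

end
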